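(* Let $r,s>0$ and let $X$ be an exponentially distributed random variable with rate parameter $\lambda>0$, distribution $P$ and density $f$. Assume $(\alpha_n)_{n\ge1}$ is an asymptotically $L^r(P)$-optimal sequence of quantizers, and let $\theta^\star=(s+1)/(r+1)$. Then the sequence $(\alpha_n^{\theta^\star,0})_{n\ge1}$ satisfies the empirical measure theorem (for the exponent $s$), i.e. $$\frac1n\sum_{a\in\alpha_n^{\theta^\star,0}}\delta_a\;\longrightarrow\;P_s\quad\text{weakly},\qquad P_s(A)=\frac{1}{C_{f,s}}\int_A f(x)^{\frac{1}{1+s}}\,dx\ \text{ for Borel }A\subset\mathbb{R},$$ where $C_{f,s}=\int_{\mathbb{R}}f(x)^{\frac{1}{1+s}}\,dx$.
   Context: Here the dimension is $d=1$; $f(x)=\lambda e^{-\lambda x}\mathbf{1}_{\{x>0\}}$; $d(x,\alpha)=\min_{a\in\alpha}|x-a|$ for a finite nonempty $\alpha\subset\mathbb{R}$. A sequence of quantizers $(\alpha_n)_{n\ge1}$ is a sequence of finite nonempty sets $\alpha_n\subset\mathbb{R}$ with $\mathrm{card}(\alpha_n)\le n$. With $e_{n,r}(P)=\inf_{\mathrm{card}(\alpha)\le n}\left(\int d(x,\alpha)^r dP(x)\right)^{1/r}$, $J_{r,1}=\inf_{n\ge1}n^{r}e_{n,r}^r(U([0,1]))$ ($U([0,1])$ uniform distribution) and $Q_r(P)=J_{r,1}\left(\int f^{1/(1+r)}dx\right)^{1+r}$, the sequence $(\alpha_n)$ is asymptotically $L^r(P)$-optimal if $\lim_n n^{r}\int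 d(x,\alpha_n)^r dP(x)=Q_r(P)$. $\alpha_n^{\theta,0}=\{\theta a:a\in\alpha_n\}$. *)

theory Defs
  imports "HOL-Probability.Probability"
begin

definition quantizer_seq :: "(nat \<Rightarrow> real set) \<Rightarrow> bool" where
  "quantizer_seq \<alpha> \<longleftrightarrow> (\<forall>n\<ge>1. finite (\<alpha> n) \<and> \<alpha> n \<noteq> {} \<and> card (\<alpha> n) \<le> n)"

definition quant_dist :: "real \<Rightarrow> real set \<Rightarrow> real" where
  "quant_dist x A = Min ((\<lambda>a. \<bar>x - a\<bar>) ` A)"

text \<open>The Bochner integral is meant for \<open>P\<close> with finite \<open>r\<close>-th moment; otherwise it would be 0
  instead of infinite. The uniform and the exponential distributions have all moments.\<close>

definition distortion :: "real \<Rightarrow> real measure \<Rightarrow> real set \<Rightarrow> real" where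
  "distortion r P A = (\<integral>x. quant_dist x A powr r \<partial>P)"

definition quant_error :: "nat \<Rightarrow> real \<Rightarrow> real measure \<Rightarrow> real" where
  "quant_error n r P =
     (INF A\<in>{A. finite A \<and> A \<noteq> {} \<and> card A \<le> n}. distortion r P A powr (1 / r))"

definition J_const :: "real \<Rightarrow> real" where
  "J_const r = (INF n\<in>{1::nat..}. real n powr r * quant_error n r (uniform_measure lborel {0..1}) powr r)"

text \<open>\<open>Q_const r f\<close> is $Q_r(P)$ for the distribution \<open>P\<close> with Lebesgue density \<open>f\<close>.\<close>

definition Q_const :: "real \<Rightarrow> (real \<Rightarrow> real) \<Rightarrow> real" where
  "Q_const r f = J_const r * (\<integral>x. f x powr (1 / (1 + r)) \<partial>lborel) powr (1 + r)"

definition asymptotically_optimal ::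
    "real \<Rightarrow> real measure \<Rightarrow> (real \<Rightarrow> real) \<Rightarrow> (nat \<Rightarrow> real set) \<Rightarrow> bool" where
  "asymptotically_optimal r P f \<alpha> \<longleftrightarrow>
     (\<lambda>n. real n powr r * distortion r P (\<alpha> n)) \<longlonglongrightarrow> Q_const r f"

text \<open>The measure $\frac1n\sum_{a\in A}\delta_a$ on the Borel sets, as the push-forward under the
  inclusion of the measure on \<open>A\<close> giving mass \<open>1/n\<close> to each point. Its total mass
  is \<open>card A / n\<close>, which need not be 1.\<close>

definition empirical_measure :: "nat \<Rightarrow> real set \<Rightarrow> real measure" where
  "empirical_measure n A = distr (point_measure A (\<lambda>_. ennreal (1 / real n))) borel (\<lambda>a. a)"

text \<open>Weak convergence tested on bounded continuous functions. The library's \<open>weak_conv_m\<close> is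
  phrased by distribution functions and agrees with this for probability measures, but not for
  finite measures in general.\<close>

definition weakly_converges :: "(nat \<Rightarrow> real measure) \<Rightarrow> real measure \<Rightarrow> bool" where
  "weakly_converges \<mu> \<nu> \<longleftrightarrow>
     (\<forall>g :: real \<Rightarrow> real. continuous_on UNIV g \<and> bounded (range g) \<longrightarrow>
        (\<lambda>n. \<integral>x. g x \<partial>\<mu> n) \<longlonglongrightarrow> (\<integral>x. g x \<partial>\<nu>))"

definition C_const :: "(real \<Rightarrow> real) \<Rightarrow> real \<Rightarrow> real" where
  "C_const f s = (\<integral>x. f x powr (1 / (1 + s)) \<partial>lborel)"

definition limit_measure :: "(real \<Rightarrow> real) \<Rightarrow> real \<Rightarrow> real measure" where
  "limit_measure f s = density lborel (\<lambda>x. ennreal (f x powr (1 / (1 + s)) / C_const f s))"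

definition empirical_measure_theorem ::
    "real \<Rightarrow> (real \<Rightarrow> real) \<Rightarrow> (nat \<Rightarrow> real set) \<Rightarrow> bool" where
  "empirical_measure_theorem s f \<alpha> \<longleftrightarrow>
     weakly_converges (\<lambda>n. empirical_measure n (\<alpha> n)) (limit_measure f s)"

text \<open>The dilation $\alpha^{\theta,0}$ about the origin.\<close>

definition dilate :: "real \<Rightarrow> real set \<Rightarrow> real set" where
  "dilate \<theta> A = (\<lambda>a. \<theta> * a) ` A"

text \<open>The density of the exponential distribution is the library's \<open>exponential_density\<close>, which
  at the single point 0 has the value \<open>\<lambda>\<close> instead of 0.\<close>

end

theory Submission
  imports Defs
begin

text \<open>
  The dilation by \<open>\<theta> = (s + 1) / (r + 1)\<close> carries the exponential distribution of rate
  \<open>\<mu> = l / (r + 1)\<close> to the one of rate \<open>l / (s + 1)\<close>, and the latter is \<open>P_s\<close>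
  (lemmas \<open>limit_measure_exponential\<close> and \<open>integral_exponential_scale\<close>). The theorem therefore
  reduces to the empirical measure theorem for the exponent \<open>r\<close> itself: the empirical
  measures \<open>E_n\<close> of \<open>\<alpha> n\<close> converge weakly to the exponential distribution \<open>\<nu>\<close> of rate \<open>\<mu>\<close>
  (lemma \<open>tendsto_mean\<close>).

  That convergence comes from a duality argument, without partitions or point counts. For every
  profile \<open>t x \<ge> 0\<close>, the distance \<open>d(x, A)\<close> satisfies
  \<open>d(x, A)^r \<ge> t(x)^r - (\<Sum>a\<in>A. max 0 (t(x)^r - \<bar>x - a\<bar>^r))\<close>, because the nearest point of \<open>A\<close>
  alone already accounts for the difference. The sum is linear in the counting measure of \<open>A\<close>,
  so integrating against \<open>P\<close> bounds the distortion below by an affine functional of that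
  measure. Take \<open>t = \<tau> / n\<close> with \<open>\<tau> x = exp (\<mu> * x + u x) / (2 * \<mu>)\<close> for a bounded continuous \<open>u\<close>; for
  \<open>u = 0\<close> this is half the distance between neighbouring points of a quantizer whose points
  have density \<open>n\<close> times that of \<open>\<nu>\<close>. Near each point \<open>\<tau>\<close> and the density are almost constant, and
  with \<open>G = l / (2 * \<mu>) powr (r + 1)\<close> the bound becomes, up to errors that vanish as \<open>n\<close> grows
  (lemma \<open>eventually_distortion_ge\<close>),
  \<open>n^r * distortion \<ge> 2 * G * \<nu>(exp (r * u)) - 2 * G * r / (r + 1) * E_n(exp ((r + 1) * u))\<close>.

  By optimality the left side tends to \<open>Q_r(P)\<close>, which is at most \<open>2 * G / (r + 1)\<close> because the
  one-point quantizer \<open>{1/2}\<close> bounds \<open>J\<close> from above. At \<open>u = 0\<close> the two sides agree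
  as soon as \<open>E_n\<close> has mass one. For \<open>u = h * v / (r + 1)\<close> the first-order term in
  \<open>h\<close> gives \<open>liminf E_n(v) \<ge> \<nu>(v)\<close>, since both exponentials are linear up to \<open>O(h\<^sup>2)\<close>
  (lemma \<open>eventually_mean_ge\<close>). Applying this to \<open>v\<close> and \<open>- v\<close> yields convergence.
\<close>

section \<open>Distance to a finite set\<close>

lemma quant_dist_attained:
  assumes "finite A" "A \<noteq> {}"
  obtains a where "a \<in> A" "quant_dist x A = \<bar>x - a\<bar>"
proof -
  have "Min ((\<lambda>a. \<bar>x - a\<bar>) ` A) \<in> (\<lambda>a. \<bar>x - a\<bar>) ` A"
    using assms by (intro Min_in) auto
  then show thesis
    using that by (auto simp: quant_dist_def)
qed

lemma quant_dist_le:
  assumes "finite A" "a \<in> A"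
  shows "quant_dist x A \<le> \<bar>x - a\<bar>"
  using assms by (auto simp: quant_dist_def intro!: Min_le)

lemma quant_dist_nonneg:
  assumes "finite A" "A \<noteq> {}"
  shows "0 \<le> quant_dist x A"
  by (rule quant_dist_attained[OF assms, of x]) simp

lemma borel_measurable_quant_dist [measurable]:
  assumes "finite A"
  shows "(\<lambda>x. quant_dist x A) \<in> borel_measurable borel"
  unfolding quant_dist_def using assms by measurable

text \<open>The summand of the point of \<open>A\<close> nearest to \<open>x\<close> closes the gap, and the other summands are
  nonnegative. This replaces the minimum over \<open>A\<close> by a sum over \<open>A\<close>, at no cost when the balls of
  radius \<open>t\<close> around the points of \<open>A\<close> do not overlap and \<open>x\<close> lies in one of them.\<close>

lemma quant_dist_powr_ge:
  assumes "finite A" "A \<noteq> {}"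
  shows "quant_dist x A powr r \<ge> t powr r - (\<Sum>a\<in>A. max 0 (t powr r - \<bar>x - a\<bar> powr r))"
proof -
  obtain a where a: "a \<in> A" "quant_dist x A = \<bar>x - a\<bar>"
    using quant_dist_attained[OF assms] .
  have "t powr r - quant_dist x A powr r \<le> max 0 (t powr r - \<bar>x - a\<bar> powr r)"
    using a by simp
  also have "\<dots> \<le> (\<Sum>a\<in>A. max 0 (t powr r - \<bar>x - a\<bar> powr r))"
    using assms a(1) by (intro member_le_sum) auto
  finally show ?thesis by simp
qed

section \<open>Integrals of capped powers and the quantization constant\<close>

lemma has_bochner_integral_abs_powr:
  fixes r t :: real
  assumes "r > 0" "t \<ge> 0"
  shows "has_bochner_integral lborel (\<lambda>y. indicator {-t..t} y * \<bar>y\<bar> powr r)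
           (2 * t powr (r + 1) / (r + 1))"
proof -
  have "((\<lambda>y::real. indicator {0..t} y * \<bar>y\<bar> powr r) has_integral t powr (r + 1) / (r + 1)) UNIV"
    using has_integral_powr_from_0[of r t] assms
    by (subst (asm) has_integral_restrict_UNIV[symmetric])
       (auto elim!: has_integral_eq_rhs has_integral_eq[rotated] simp: indicator_def)
  then have "integral\<^sup>N lborel (\<lambda>y::real. ennreal (indicator {0..t} y * \<bar>y\<bar> powr r))
       = ennreal (t powr (r + 1) / (r + 1))"
    by (intro nn_integral_has_integral_lborel) auto
  then have "has_bochner_integral lborel (\<lambda>y::real. indicator {0..t} y * \<bar>y\<bar> powr r)
       (t powr (r + 1) / (r + 1))"
    using assms by (intro has_bochner_integral_nn_integral) auto
  also have "(\<lambda>y::real. indicator {0..t} y * \<bar>y\<bar> powr r) =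
      (\<lambda>y. indicator {0..} y *\<^sub>R (indicator {-t..t} y * \<bar>y\<bar> powr r))"
    using assms by (auto simp: fun_eq_iff indicator_def)
  finally have "has_bochner_integral lborel (\<lambda>y. indicator {-t..t} y * \<bar>y\<bar> powr r)
      (2 *\<^sub>R (t powr (r + 1) / (r + 1)))"
    by (rule has_bochner_integral_even_function) (auto simp: indicator_def)
  then show ?thesis by simp
qed

lemma has_bochner_integral_powr_cap:
  fixes r t p :: real
  assumes "r > 0" "t \<ge> 0"
  shows "has_bochner_integral lborel (\<lambda>x. max 0 (t powr r - \<bar>x - p\<bar> powr r))
           (2 * r / (r + 1) * t powr (r + 1))"
proof -
  have "has_bochner_integral lborel (indicator {-t..t}) (measure lborel {-t..t})"
    by (intro has_bochner_integral_real_indicator) (auto simp: emeasure_lborel_Icc_eq)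
  then have "has_bochner_integral lborel (indicator {-t..t}) (2 * t)"
    using assms by simp
  then have "has_bochner_integral lborel (\<lambda>y. t powr r * indicator {-t..t} y) (t powr r * (2 * t))"
    by (intro has_bochner_integral_mult_right) auto
  from has_bochner_integral_diff[OF this has_bochner_integral_abs_powr[OF assms]]
  have "has_bochner_integral lborel
      (\<lambda>y. t powr r * indicator {-t..t} y - indicator {-t..t} y * \<bar>y\<bar> powr r)
      (t powr r * (2 * t) - 2 * t powr (r + 1) / (r + 1))" .
  also have "(\<lambda>y. t powr r * indicator {-t..t} y - indicator {-t..t} y * \<bar>y\<bar> powr r)
      = (\<lambda>y. max 0 (t powr r - \<bar>y\<bar> powr r))"
  proof
    fix y :: real
    have "\<bar>y\<bar> \<le> t \<longleftrightarrow> \<bar>y\<bar> powr r \<le> t powr r"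
      using assms powr_mono2[of r "\<bar>y\<bar>" t] powr_less_mono2[of r t "\<bar>y\<bar>"] by linarith
    then show "t powr r * indicator {-t..t} y - indicator {-t..t} y * \<bar>y\<bar> powr r
        = max 0 (t powr r - \<bar>y\<bar> powr r)"
      by (auto simp: indicator_def)
  qed
  also have "t powr r * (2 * t) - 2 * t powr (r + 1) / (r + 1) = 2 * r / (r + 1) * t powr (r + 1)"
    using assms by (simp add: powr_add field_simps)
  finally show ?thesis
    by (subst lborel_has_bochner_integral_real_affine_iff[where c = 1 and t = p]) auto
qed

text \<open>The right-hand side is the distortion of the one-point quantizer \<open>{1/2}\<close>. It is the exact value
  of the constant, which is why this bound meets the lower bound for the distortion that is
  proved below.\<close>

lemma J_const_le:
  assumes "r > 0"
  shows "J_const r \<le> 1 / (2 powr r * (r + 1))"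
proof -
  define U :: "real measure" where "U = uniform_measure lborel {0..1}"
  have U: "U = density lborel (\<lambda>x. ennreal (indicator {0..1} x))"
    unfolding U_def uniform_measure_def by (intro density_cong) (auto simp: indicator_def)
  have "distortion r U {1/2} = (\<integral>x. \<bar>x - 1/2\<bar> powr r \<partial>U)"
    by (simp add: distortion_def quant_dist_def)
  also have "\<dots> = (\<integral>x. indicator {0..1} x * \<bar>x - 1/2\<bar> powr r \<partial>lborel)"
    unfolding U by (subst integral_real_density) auto
  also have "\<dots> = (\<integral>y. indicator {-(1/2)..1/2} y * \<bar>y\<bar> powr r \<partial>lborel)"
    by (subst lborel_integral_real_affine[where c = 1 and t = "1/2"])
       (auto intro!: Bochner_Integration.integral_cong simp: indicator_def)
  also have "\<dots> = 2 * (1/2) powr (r + 1) / (r + 1)"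
    using has_bochner_integral_abs_powr[of r "1/2"] assms by (simp add: has_bochner_integral_iff)
  also have "\<dots> = 1 / (2 powr r * (r + 1))"
    by (simp add: powr_add powr_divide)
  finally have D: "distortion r U {1/2} = 1 / (2 powr r * (r + 1))" .
  have "quant_error 1 r U \<le> distortion r U {1/2} powr (1/r)"
    unfolding quant_error_def by (rule cINF_lower) (auto intro!: bdd_belowI[of _ 0])
  moreover have "0 \<le> quant_error 1 r U"
    unfolding quant_error_def by (rule cINF_greatest) (auto intro!: exI[of _ "{0}"])
  ultimately have "quant_error 1 r U powr r \<le> (distortion r U {1/2} powr (1/r)) powr r"
    using assms by (intro powr_mono2) auto
  also have "\<dots> = 1 / (2 powr r * (r + 1))"
    using assms by (simp add: powr_powr D)
  finally have "real 1 powr r * quant_error 1 r U powr r \<le> 1 / (2 powr r * (r + 1))" by simp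
  moreover have "J_const r \<le> real 1 powr r * quant_error 1 r U powr r"
    unfolding J_const_def U_def by (rule cINF_lower) (auto intro!: bdd_belowI[of _ 0])
  ultimately show ?thesis by linarith
qed

section \<open>Powers, scaling and moments of the exponential density\<close>

text \<open>A power of an exponential density is again an exponential density up to a factor. This is
  the reason why \<open>P_s\<close> is exponential, and why all the measures \<open>P_s\<close> are dilates of each other.\<close>

lemma exponential_density_powr:
  assumes "l > 0" "q > 0"
  shows "exponential_density l x powr q = l powr q / (l * q) * exponential_density (l * q) x"
  using assms by (auto simp: exponential_density_def powr_mult exp_powr_real field_simps)

lemma integral_exponential_density:
  assumes "l > 0"
  shows "(\<integral>x. exponential_density l x \<partial>lborel) = 1"
proof -
  interpret prob_space "density lborel (exponential_density l)"
    by (rule prob_space_exponential_density[OF assms])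
  show ?thesis
    using prob_space assms integral_real_density[of "exponential_density l" lborel "\<lambda>_. 1"]
    by (simp add: exponential_density_def)
qed

lemma C_const_exponential:
  assumes "l > 0" "s > 0"
  shows "C_const (exponential_density l) s = l powr (1 / (1 + s)) * (1 + s) / l"
  using assms integral_exponential_density[of "l / (1 + s)"]
  by (simp add: C_const_def exponential_density_powr)

lemma limit_measure_exponential:
  assumes "l > 0" "s > 0"
  shows "limit_measure (exponential_density l) s = density lborel (exponential_density (l / (1 + s)))"
proof -
  have "exponential_density l x powr (1 / (1 + s)) / C_const (exponential_density l) s
      = exponential_density (l / (1 + s)) x" for x
    using assms by (simp add: C_const_exponential exponential_density_powr)
  then show ?thesis by (simp add: limit_measure_def)
qed

text \<open>The form of the bound matches the lower bound of \<open>eventually_distortion_ge\<close>: with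
  \<open>G = l / (2 * \<mu>) powr (r + 1)\<close>, it is \<open>2 * G - 2 * G * r / (r + 1)\<close>.\<close>

lemma Q_const_exponential_le:
  assumes "l > 0" "r > 0"
  defines "\<mu> \<equiv> l / (r + 1)"
  shows "Q_const r (exponential_density l) \<le> 2 * (l / (2 * \<mu>) powr (r + 1)) / (r + 1)"
proof -
  have \<mu>: "\<mu> > 0" using assms by simp
  have "(\<integral>x. exponential_density l x powr (1 / (1 + r)) \<partial>lborel) = l powr (1 / (1 + r)) / \<mu>"
    using C_const_exponential[of l r] assms by (simp add: C_const_def add.commute)
  then have "Q_const r (exponential_density l) = J_const r * (l / \<mu> powr (r + 1))"
    using \<open>l > 0\<close> \<open>r > 0\<close> \<mu> by (simp add: Q_const_def powr_divide powr_powr add.commute)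
  also have "\<dots> \<le> 1 / (2 powr r * (r + 1)) * (l / \<mu> powr (r + 1))"
    using assms by (intro mult_right_mono J_const_le) auto
  also have "\<dots> = 2 * (l / (2 * \<mu>) powr (r + 1)) / (r + 1)"
    using \<mu> by (simp add: powr_mult powr_add)
  finally show ?thesis .
qed


lemma integral_exponential_scale:
  fixes g :: "real \<Rightarrow> real"
  assumes "l > 0" "\<theta> > 0" and [measurable]: "g \<in> borel_measurable borel"
  shows "(\<integral>x. g (\<theta> * x) \<partial>density lborel (exponential_density (l * \<theta>)))
    = (\<integral>x. g x \<partial>density lborel (exponential_density l))"
proof -
  have "(\<integral>x. g x \<partial>density lborel (exponential_density l))
      = \<theta> * (\<integral>x. exponential_density l (\<theta> * x) * g (\<theta> * x) \<partial>lborel)"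
    using assms lborel_integral_real_affine[of \<theta> "\<lambda>x. exponential_density l x * g x" 0]
    by (simp add: integral_real_density exponential_density_def)
  also have "\<dots> = (\<integral>x. \<theta> * (exponential_density l (\<theta> * x) * g (\<theta> * x)) \<partial>lborel)"
    by simp
  also have "\<dots> = (\<integral>x. exponential_density (l * \<theta>) x * g (\<theta> * x) \<partial>lborel)"
    using assms by (intro Bochner_Integration.integral_cong)
      (auto simp: exponential_density_def zero_le_mult_iff mult_less_0_iff algebra_simps)
  also have "\<dots> = (\<integral>x. g (\<theta> * x) \<partial>density lborel (exponential_density (l * \<theta>)))"
    using assms by (simp add: integral_real_density exponential_density_def)
  finally show ?thesis ..
qed

lemma abs_powr_le_exp:
  fixes x r \<delta> :: real
  assumes "r > 0" "\<delta> > 0"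
  shows "\<bar>x\<bar> powr r \<le> exp (r * \<delta> * \<bar>x\<bar>) / \<delta> powr r"
proof -
  have "\<delta> * \<bar>x\<bar> \<le> exp (\<delta> * \<bar>x\<bar>)"
    using exp_ge_add_one_self[of "\<delta> * \<bar>x\<bar>"] by linarith
  then have "(\<delta> * \<bar>x\<bar>) powr r \<le> exp (\<delta> * \<bar>x\<bar>) powr r"
    using assms by (intro powr_mono2) auto
  then show ?thesis
    using assms by (simp add: powr_mult exp_powr_real field_simps)
qed

text \<open>Integrability is needed because the Bochner integral of a non-integrable function is \<open>0\<close>, which
  would defeat every lower bound for the distortion. Half of the exponential decay absorbs
  the power of the distance to one chosen point of \<open>A\<close>.\<close>

lemma integrable_quant_dist_powr:
  assumes "l > 0" "r > 0" "finite A" "A \<noteq> {}"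
  shows "integrable (density lborel (exponential_density l)) (\<lambda>x. quant_dist x A powr r)"
proof -
  obtain a where a: "a \<in> A" using assms by auto
  define \<delta> where "\<delta> = l / (2 * r)"
  have \<delta>: "\<delta> > 0" "r * \<delta> = l / 2" using assms by (auto simp: \<delta>_def)
  define C where "C = 2 * exp (l / 2 * \<bar>a\<bar>) / \<delta> powr r"
  have "integrable lborel (\<lambda>x. exponential_density l x * quant_dist x A powr r)"
  proof (rule Bochner_Integration.integrable_bound)
    have "(\<integral>x. exponential_density (l / 2) x \<partial>lborel) \<noteq> 0"
      using integral_exponential_density[of "l / 2"] assms by simp
    then show "integrable lborel (\<lambda>x. C * exponential_density (l / 2) x)"
      using not_integrable_integral_eq[of lborel "exponential_density (l / 2)"]
      by (intro integrable_mult_right) blast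
    show "(\<lambda>x. exponential_density l x * quant_dist x A powr r) \<in> borel_measurable lborel"
      using assms by measurable
    show "AE x in lborel. norm (exponential_density l x * quant_dist x A powr r)
            \<le> norm (C * exponential_density (l / 2) x)"
    proof (rule AE_I2)
      fix x :: real
      show "norm (exponential_density l x * quant_dist x A powr r)
            \<le> norm (C * exponential_density (l / 2) x)"
      proof (cases "x < 0")
        case False
        have "quant_dist x A powr r \<le> \<bar>x - a\<bar> powr r"
          using assms a by (intro powr_mono2 quant_dist_le quant_dist_nonneg) auto
        also have "\<dots> \<le> exp (l / 2 * \<bar>x - a\<bar>) / \<delta> powr r"
          using abs_powr_le_exp[of r \<delta> "x - a"] \<delta> assms by simp
        also have "\<dots> \<le> exp (l / 2 * x + l / 2 * \<bar>a\<bar>) / \<delta> powr r"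
        proof -
          have "l / 2 * \<bar>x - a\<bar> \<le> l / 2 * (x + \<bar>a\<bar>)"
            using False assms by (intro mult_left_mono) auto
          then show ?thesis by (auto simp: algebra_simps intro!: divide_right_mono)
        qed
        finally have "l * exp (- x * l) * quant_dist x A powr r
            \<le> l * exp (- x * l) * (exp (l / 2 * x + l / 2 * \<bar>a\<bar>) / \<delta> powr r)"
          using assms by (intro mult_left_mono) auto
        also have "\<dots> = C * (l / 2 * exp (- x * (l / 2)))"
          by (simp add: C_def exp_add[symmetric] field_simps)
        finally show ?thesis
          using False assms by (simp add: exponential_density_def C_def abs_mult)
      qed (simp add: exponential_density_def)
    qed
  qed
  then show ?thesis
    using assms by (subst integrable_real_density) (auto simp: exponential_density_def)
qed

section \<open>The dual lower bound for the distortion\<close>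

text \<open>The profile \<open>t\<close> may vary with \<open>x\<close>, and it is the free parameter of the method: the right-hand side
  depends on \<open>A\<close> only through a sum over its points.\<close>

lemma distortion_ge_powr_caps:
  assumes "finite_measure P" "sets P = sets borel" "r > 0" "finite A" "A \<noteq> {}"
    and int: "integrable P (\<lambda>x. quant_dist x A powr r)"
    and [measurable]: "t \<in> borel_measurable borel"
    and t: "\<And>x. 0 \<le> t x" "\<And>x. t x \<le> T"
  shows "distortion r P A \<ge>
    (\<integral>x. t x powr r \<partial>P) - (\<Sum>a\<in>A. \<integral>x. max 0 (t x powr r - \<bar>x - a\<bar> powr r) \<partial>P)"
proof -
  interpret finite_measure P by fact
  have [measurable_cong]: "sets P = sets borel" by fact
  have tr: "t x powr r \<le> T powr r" for x
    using t assms by (intro powr_mono2) auto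
  have i1: "integrable P (\<lambda>x. t x powr r)"
    using tr by (intro integrable_const_bound[of _ "T powr r"]) auto
  have i2: "integrable P (\<lambda>x. max 0 (t x powr r - \<bar>x - a\<bar> powr r))" for a
  proof (rule integrable_const_bound[of _ "T powr r"])
    show "AE x in P. norm (max 0 (t x powr r - \<bar>x - a\<bar> powr r)) \<le> T powr r"
    proof (rule AE_I2)
      fix x
      have "t x powr r - \<bar>x - a\<bar> powr r \<le> T powr r"
        using tr[of x] powr_ge_zero[of "\<bar>x - a\<bar>" r] by linarith
      then show "norm (max 0 (t x powr r - \<bar>x - a\<bar> powr r)) \<le> T powr r" by simp
    qed
  qed auto
  have "(\<integral>x. t x powr r \<partial>P) - (\<Sum>a\<in>A. \<integral>x. max 0 (t x powr r - \<bar>x - a\<bar> powr r) \<partial>P)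
      = (\<integral>x. t x powr r - (\<Sum>a\<in>A. max 0 (t x powr r - \<bar>x - a\<bar> powr r)) \<partial>P)"
    using i1 i2 by (subst Bochner_Integration.integral_diff) (auto simp: Bochner_Integration.integral_sum)
  also have "\<dots> \<le> distortion r P A"
    unfolding distortion_def
  proof (rule integral_mono[OF _ int])
    show "integrable P (\<lambda>x. t x powr r - (\<Sum>a\<in>A. max 0 (t x powr r - \<bar>x - a\<bar> powr r)))"
      by (intro Bochner_Integration.integrable_diff Bochner_Integration.integrable_sum i1 i2)
    show "t x powr r - (\<Sum>a\<in>A. max 0 (t x powr r - \<bar>x - a\<bar> powr r)) \<le> quant_dist x A powr r" for x
      by (rule quant_dist_powr_ge[OF \<open>finite A\<close> \<open>A \<noteq> {}\<close>])
  qed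
  finally show ?thesis .
qed

text \<open>Only points \<open>x\<close> with \<open>\<bar>x - a\<bar> < t x\<close> contribute. Hence upper bounds \<open>C\<close> for the density and \<open>S\<close> for
  the profile on that neighbourhood of \<open>a\<close> suffice to compare with constant density and profile.\<close>

lemma integral_powr_cap_le:
  fixes f t :: "real \<Rightarrow> real"
  assumes "r > 0" "S \<ge> 0" "C \<ge> 0"
    and [measurable]: "f \<in> borel_measurable borel" "t \<in> borel_measurable borel"
    and f: "\<And>x. 0 \<le> f x" and t: "\<And>x. 0 \<le> t x"
    and bound: "\<And>x. f x \<noteq> 0 \<Longrightarrow> \<bar>x - a\<bar> < t x \<Longrightarrow> f x \<le> C \<and> t x \<le> S"
  shows "(\<integral>x. max 0 (t x powr r - \<bar>x - a\<bar> powr r) \<partial>density lborel f)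
           \<le> C * (2 * r / (r + 1) * S powr (r + 1))"
proof -
  note cap = has_bochner_integral_powr_cap[OF \<open>r > 0\<close> \<open>S \<ge> 0\<close>, of a]
  have "(\<integral>x. max 0 (t x powr r - \<bar>x - a\<bar> powr r) \<partial>density lborel f)
      = (\<integral>x. f x * max 0 (t x powr r - \<bar>x - a\<bar> powr r) \<partial>lborel)"
    using f by (subst integral_real_density) auto
  also have "\<dots> \<le> (\<integral>x. C * max 0 (S powr r - \<bar>x - a\<bar> powr r) \<partial>lborel)"
  proof (rule integral_mono')
    show "integrable lborel (\<lambda>x. C * max 0 (S powr r - \<bar>x - a\<bar> powr r))"
      using cap by (auto simp: has_bochner_integral_iff)
    show "0 \<le> C * max 0 (S powr r - \<bar>x - a\<bar> powr r)" for x using \<open>C \<ge> 0\<close> by simp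
    show "f x * max 0 (t x powr r - \<bar>x - a\<bar> powr r) \<le> C * max 0 (S powr r - \<bar>x - a\<bar> powr r)" for x
    proof (cases "f x \<noteq> 0 \<and> \<bar>x - a\<bar> < t x")
      case True
      then have "f x \<le> C" "t x powr r \<le> S powr r"
        using bound[of x] assms t[of x] by (auto intro!: powr_mono2)
      then show ?thesis using f assms by (intro mult_mono) auto
    next
      case False
      then have "f x = 0 \<or> t x powr r \<le> \<bar>x - a\<bar> powr r"
        using t[of x] assms by (auto intro!: powr_mono2)
      then have eq: "f x * max 0 (t x powr r - \<bar>x - a\<bar> powr r) = 0" by auto
      show ?thesis unfolding eq using \<open>C \<ge> 0\<close> by simp
    qed
  qed
  also have "\<dots> = C * (2 * r / (r + 1) * S powr (r + 1))"
    using cap by (simp add: has_bochner_integral_iff)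
  finally show ?thesis .
qed


text \<open>The profile is \<open>\<tau> / n\<close> with \<open>\<tau> x = exp (\<mu> * x + u x) / (2 * \<mu>)\<close>. The growth rate \<open>\<mu>\<close> is chosen so that
  \<open>exponential_density l x * \<tau> x powr (r + 1) = G * exp ((r + 1) * u x)\<close> for \<open>x \<ge> 0\<close>: the decay of the
  density cancels, and a point \<open>a\<close> costs an amount that depends on \<open>a\<close> only through \<open>u a\<close>. Cutting the
  profile off at \<open>R\<close> makes it bounded and needs \<open>u\<close> to be uniformly continuous only on a compact
  interval; this gives an estimate uniform in the position of \<open>a\<close>, whereas without the cutoff
  the radius \<open>\<tau> / n\<close> would be unbounded for each \<open>n\<close>. The factor \<open>\<kappa>\<close> absorbs the oscillation
  of density and profile within one radius.\<close>

lemma eventually_distortion_ge: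
  fixes l r :: real
  assumes "l > 0" "r > 0" "\<kappa> > 1"
    and u: "continuous_on UNIV u" "\<And>x. \<bar>u x\<bar> \<le> B"
  defines "\<mu> \<equiv> l / (r + 1)"
  defines "G \<equiv> l / (2 * \<mu>) powr (r + 1)"
  shows "\<forall>\<^sub>F n in sequentially. \<forall>A. finite A \<and> A \<noteq> {} \<longrightarrow>
    real n powr r * distortion r (density lborel (exponential_density l)) A \<ge>
      2 * G * (\<integral>x. indicator {..R} x * exp (r * u x) \<partial>density lborel (exponential_density \<mu>))
      - \<kappa> * (2 * r / (r + 1) * G) * ((\<Sum>a\<in>A. exp ((r + 1) * u a)) / real n)"
proof -
  have \<mu>: "\<mu> > 0" "\<mu> * (r + 1) = l" using assms by (auto simp: \<mu>_def)
  have [measurable]: "u \<in> borel_measurable borel"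
    using u by (intro borel_measurable_continuous_onI)
  define \<tau> where "\<tau> x = exp (\<mu> * x + u x) / (2 * \<mu>)" for x
  have [measurable]: "\<tau> \<in> borel_measurable borel" unfolding \<tau>_def by measurable
  define T where "T = exp (\<mu> * R + B) / (2 * \<mu>)"
  have T: "\<tau> x \<le> T" if "x \<le> R" for x
    unfolding \<tau>_def T_def using \<mu> that u(2)[of x]
    by (intro divide_right_mono) (auto intro!: add_mono)
  \<comment> \<open>One third of \<open>ln \<kappa>\<close> each for the density, for \<open>\<mu> * x\<close> and for \<open>u x\<close> in the power \<open>r + 1\<close> of \<open>\<tau>\<close>.\<close>
  define \<gamma> where "\<gamma> = ln \<kappa> / 3"
  have \<gamma>: "\<gamma> > 0" "exp (3 * \<gamma>) = \<kappa>" using assms by (auto simp: \<gamma>_def)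
  have "uniformly_continuous_on {-1..R+1} u"
    using u by (intro compact_uniformly_continuous) (auto intro: continuous_on_subset)
  then obtain d where d: "d > 0"
    "\<And>x y. x \<in> {-1..R+1} \<Longrightarrow> y \<in> {-1..R+1} \<Longrightarrow> dist y x < d \<Longrightarrow> dist (u y) (u x) < \<gamma> / (r + 1)"
    unfolding uniformly_continuous_on_def
    using \<gamma> assms by (metis add_pos_pos divide_pos_pos zero_less_one)
  \<comment> \<open>The bound \<open>1\<close> keeps \<open>a\<close> in the interval of uniform continuity when \<open>x\<close> lies in \<open>{0..R}\<close>.\<close>
  define \<delta> where "\<delta> = min 1 (min d (\<gamma> / l))"
  have \<delta>: "\<delta> > 0" "\<delta> \<le> 1" "\<delta> \<le> d" "\<delta> \<le> \<gamma> / l"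
    using d \<gamma> assms by (auto simp: \<delta>_def)
  have "(\<lambda>n. T / real n) \<longlonglongrightarrow> 0" by real_asymp
  then have "\<forall>\<^sub>F n in sequentially. T / real n < \<delta>"
    using \<delta> by (intro order_tendstoD) auto
  then show ?thesis
    using eventually_ge_at_top[of 1]
  proof eventually_elim
    case (elim n)
    have n: "real n > 0" using elim by simp
    show ?case
    proof (intro allI impI, elim conjE)
      fix A :: "real set" assume A: "finite A" "A \<noteq> {}"
      define t where "t x = indicator {..R} x * (\<tau> x / real n)" for x
      have [measurable]: "t \<in> borel_measurable borel" unfolding t_def by measurable
      have \<tau>_pos: "\<tau> x > 0" for x using \<mu> by (simp add: \<tau>_def)
      have t: "0 \<le> t x" for x
        using \<tau>_pos[of x] by (simp add: t_def)
      have "T > 0" using \<mu> by (simp add: T_def)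
      have tT: "t x \<le> T / real n" for x
        using T[of x] n \<open>T > 0\<close> by (auto simp: t_def indicator_def divide_right_mono)
      let ?P = "density lborel (exponential_density l)"
      interpret prob_space ?P by (rule prob_space_exponential_density) fact
      have cap: "(\<integral>x. max 0 (t x powr r - \<bar>x - a\<bar> powr r) \<partial>?P)
          \<le> \<kappa> * (2 * r / (r + 1) * G) * exp ((r + 1) * u a) / real n powr (r + 1)" for a
      proof -
        define C where "C = exp \<gamma> * (l * exp (- a * l))"
        define S where "S = exp (2 * \<gamma> / (r + 1)) * (\<tau> a / real n)"
        have "(\<integral>x. max 0 (t x powr r - \<bar>x - a\<bar> powr r) \<partial>?P)
            \<le> C * (2 * r / (r + 1) * S powr (r + 1))"
        proof (rule integral_powr_cap_le)
          fix x assume x: "exponential_density l x \<noteq> 0" "\<bar>x - a\<bar> < t x"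
          have "x \<ge> 0" using x(1) by (auto simp: exponential_density_def split: if_splits)
          have "x \<le> R" using x(2) by (cases "x \<le> R") (auto simp: t_def)
          have xa: "\<bar>x - a\<bar> < \<delta>" using x(2) tT[of x] elim by linarith
          have "a \<in> {-1..R+1}" "x \<in> {-1..R+1}" "dist x a < d"
            using xa \<delta> \<open>x \<ge> 0\<close> \<open>x \<le> R\<close> by (auto simp: dist_real_def)
          then have "dist (u x) (u a) < \<gamma> / (r + 1)" by (intro d)
          then have ux: "u x \<le> u a + \<gamma> / (r + 1)" by (auto simp: dist_real_def)
          have "l * \<bar>x - a\<bar> \<le> l * (\<gamma> / l)"
            using xa \<delta> assms by (intro mult_left_mono) auto
          then have la: "l * \<bar>x - a\<bar> \<le> \<gamma>" using assms by simp
          have "\<mu> * \<bar>x - a\<bar> = l * \<bar>x - a\<bar> / (r + 1)" by (simp add: \<mu>_def)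
          also have "\<dots> \<le> \<gamma> / (r + 1)" using la assms by (intro divide_right_mono) auto
          finally have ma: "\<mu> * \<bar>x - a\<bar> \<le> \<gamma> / (r + 1)" .
          have "- x * l \<le> \<gamma> + - a * l"
          proof -
            have "l * (a - x) \<le> l * \<bar>x - a\<bar>" using assms by (intro mult_left_mono) auto
            then show ?thesis using la by (simp add: algebra_simps)
          qed
          then have "exp (- x * l) \<le> exp \<gamma> * exp (- a * l)"
            by (simp add: exp_add[symmetric])
          then have 1: "exponential_density l x \<le> C"
            using \<open>x \<ge> 0\<close> assms by (simp add: exponential_density_def C_def field_simps)
          have "\<mu> * (x - a) \<le> \<mu> * \<bar>x - a\<bar>" using \<mu> by (intro mult_left_mono) auto
          then have "\<mu> * x + u x \<le> 2 * \<gamma> / (r + 1) + (\<mu> * a + u a)"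
            using ma ux by (simp add: right_diff_distrib)
          then have "exp (\<mu> * x + u x) \<le> exp (2 * \<gamma> / (r + 1)) * exp (\<mu> * a + u a)"
            unfolding exp_add[symmetric] by simp
          then have "\<tau> x \<le> exp (2 * \<gamma> / (r + 1)) * \<tau> a"
            using \<mu> by (simp add: \<tau>_def divide_right_mono)
          then have 2: "t x \<le> S"
            using n \<open>x \<le> R\<close> by (simp add: t_def S_def divide_right_mono)
          from 1 2 show "exponential_density l x \<le> C \<and> t x \<le> S" ..
        qed (use assms t n \<tau>_pos[of a] in \<open>auto simp: C_def S_def exponential_density_def\<close>)
        also have "\<dots> = \<kappa> * (2 * r / (r + 1) * G) * exp ((r + 1) * u a) / real n powr (r + 1)"
        proof -
          have "\<tau> a powr (r + 1) = exp ((\<mu> * a + u a) * (r + 1)) / (2 * \<mu>) powr (r + 1)"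
            using \<mu> by (simp add: \<tau>_def powr_divide exp_powr_real)
          also have "(\<mu> * a + u a) * (r + 1) = a * l + (r + 1) * u a"
            unfolding \<mu>(2)[symmetric] by (simp add: algebra_simps)
          finally have \<tau>r: "\<tau> a powr (r + 1) = exp (a * l) * exp ((r + 1) * u a) / (2 * \<mu>) powr (r + 1)"
            by (simp add: exp_add)
          have "S powr (r + 1) = exp (2 * \<gamma>) * (\<tau> a powr (r + 1) / real n powr (r + 1))"
            using assms \<tau>_pos[of a] n by (simp add: S_def powr_mult powr_divide exp_powr_real)
          moreover have "\<kappa> = exp \<gamma> * exp (2 * \<gamma>)"
            using \<gamma>(2) by (simp add: exp_add[symmetric])
          moreover have "exp (- a * l) * exp (a * l) = 1" by (simp add: exp_add[symmetric])
          ultimately show ?thesis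
            unfolding C_def G_def \<tau>r by (simp add: field_simps)
        qed
        finally show ?thesis .
      qed
      have main: "(\<integral>x. t x powr r \<partial>?P) = 2 * G / real n powr r *
          (\<integral>x. indicator {..R} x * exp (r * u x) \<partial>density lborel (exponential_density \<mu>))"
      proof -
        have "exponential_density l x * t x powr r = 2 * G / real n powr r *
            (exponential_density \<mu> x * (indicator {..R} x * exp (r * u x)))" for x
        proof (cases "0 \<le> x \<and> x \<le> R")
          case True
          have "\<tau> x powr r = exp ((\<mu> * x + u x) * r) / (2 * \<mu>) powr r"
            using \<mu> by (simp add: \<tau>_def powr_divide exp_powr_real)
          moreover have "- x * l + (\<mu> * x + u x) * r = - x * \<mu> + r * u x"
            unfolding \<mu>(2)[symmetric] by (simp add: algebra_simps)
          ultimately have "exp (- x * l) * \<tau> x powr r = exp (- x * \<mu>) * exp (r * u x) / (2 * \<mu>) powr r"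
            by (metis exp_add times_divide_eq_right)
          then have e: "l * (exp (- x * l) * \<tau> x powr r) / real n powr r
              = l / (2 * \<mu>) powr r * (exp (- x * \<mu>) * exp (r * u x)) / real n powr r" by simp
          have G\<mu>: "l / (2 * \<mu>) powr r = 2 * G * \<mu>"
            using \<mu> by (simp add: G_def powr_add field_simps)
          have "exponential_density l x * t x powr r = l * (exp (- x * l) * \<tau> x powr r) / real n powr r"
            using True n \<tau>_pos[of x] by (simp add: exponential_density_def t_def powr_divide)
          then show ?thesis
            using True unfolding e G\<mu> by (simp add: exponential_density_def)
        qed (auto simp: exponential_density_def t_def)
        then show ?thesis
          using assms \<mu> by (simp add: integral_real_density exponential_density_def)
      qed
      have "distortion r ?P A \<ge> (\<integral>x. t x powr r \<partial>?P) -
          (\<Sum>a\<in>A. \<integral>x. max 0 (t x powr r - \<bar>x - a\<bar> powr r) \<partial>?P)"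
        using assms A t tT
        by (intro distortion_ge_powr_caps integrable_quant_dist_powr) (auto intro: finite_measure_axioms)
      moreover have "(\<Sum>a\<in>A. \<integral>x. max 0 (t x powr r - \<bar>x - a\<bar> powr r) \<partial>?P) \<le>
          (\<Sum>a\<in>A. \<kappa> * (2 * r / (r + 1) * G) * exp ((r + 1) * u a) / real n powr (r + 1))"
        by (intro sum_mono cap)
      moreover have "\<dots> = \<kappa> * (2 * r / (r + 1) * G) * (\<Sum>a\<in>A. exp ((r + 1) * u a)) / real n powr (r + 1)"
        by (simp add: sum_distrib_left sum_divide_distrib)
      ultimately have "(\<integral>x. t x powr r \<partial>?P) -
          \<kappa> * (2 * r / (r + 1) * G) * (\<Sum>a\<in>A. exp ((r + 1) * u a)) / real n powr (r + 1)
          \<le> distortion r ?P A" by linarith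
      then have "real n powr r * ((\<integral>x. t x powr r \<partial>?P) -
          \<kappa> * (2 * r / (r + 1) * G) * (\<Sum>a\<in>A. exp ((r + 1) * u a)) / real n powr (r + 1))
          \<le> real n powr r * distortion r ?P A"
        by (intro mult_left_mono) auto
      also have "real n powr r * ((\<integral>x. t x powr r \<partial>?P) -
          \<kappa> * (2 * r / (r + 1) * G) * (\<Sum>a\<in>A. exp ((r + 1) * u a)) / real n powr (r + 1)) =
          2 * G * (\<integral>x. indicator {..R} x * exp (r * u x) \<partial>density lborel (exponential_density \<mu>))
          - \<kappa> * (2 * r / (r + 1) * G) * ((\<Sum>a\<in>A. exp ((r + 1) * u a)) / real n)"
        unfolding main using n by (simp add: powr_add right_diff_distrib)
      finally show "2 * G * (\<integral>x. indicator {..R} x * exp (r * u x) \<partial>density lborel (exponential_density \<mu>))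
          - \<kappa> * (2 * r / (r + 1) * G) * ((\<Sum>a\<in>A. exp ((r + 1) * u a)) / real n)
          \<le> real n powr r * distortion r ?P A" .
    qed
  qed
qed

section \<open>Consequences of asymptotic optimality\<close>

lemma mean_le:
  assumes "finite A" "card A \<le> n" "n > 0" "K \<ge> 0" "\<And>a. g a \<le> K"
  shows "(\<Sum>a\<in>A. g a) / real n \<le> (K :: real)"
proof -
  have "(\<Sum>a\<in>A. g a) \<le> real (card A) * K"
    using assms by (intro sum_bounded_above) auto
  also have "\<dots> \<le> real n * K" using assms by (intro mult_right_mono) auto
  finally show ?thesis using assms by (simp add: field_simps)
qed

text \<open>The lower bound for \<open>n^r * distortion\<close> is compared with its limit, which is at most
  \<open>2 * G / (r + 1)\<close>, and divided by \<open>2 * G\<close>. One third of \<open>\<eta>\<close> pays for each of the cutoff at \<open>R\<close>, the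
  distance to the limit, and the factor \<open>\<kappa>\<close>.\<close>

lemma eventually_exp_mean_ge:
  fixes l r :: real
  assumes "l > 0" "r > 0" "\<eta> > 0"
    and \<alpha>: "quantizer_seq \<alpha>"
    and opt: "asymptotically_optimal r (density lborel (exponential_density l)) (exponential_density l) \<alpha>"
    and u: "continuous_on UNIV u" "\<And>x. \<bar>u x\<bar> \<le> B"
  defines "\<mu> \<equiv> l / (r + 1)"
  shows "\<forall>\<^sub>F n in sequentially.
    r / (r + 1) * ((\<Sum>a\<in>\<alpha> n. exp ((r + 1) * u a)) / real n) \<ge>
      (\<integral>x. exp (r * u x) \<partial>density lborel (exponential_density \<mu>)) - 1 / (r + 1) - \<eta>"
proof -
  have \<mu>: "\<mu> > 0" using assms by (auto simp: \<mu>_def)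
  have [measurable]: "u \<in> borel_measurable borel"
    using u by (intro borel_measurable_continuous_onI)
  let ?Q = "density lborel (exponential_density \<mu>)"
  interpret prob_space ?Q by (rule prob_space_exponential_density) fact
  define G where "G = l / (2 * \<mu>) powr (r + 1)"
  have G: "G > 0" using assms \<mu> by (simp add: G_def)
  define \<nu> where "\<nu> = (\<integral>x. exp (r * u x) \<partial>?Q)"
  have "integrable ?Q (\<lambda>x. exp (r * u x))"
  proof (rule integrable_const_bound[of _ "exp (r * B)"])
    have "u x \<le> B" for x using u(2)[of x] by linarith
    then show "AE x in ?Q. norm (exp (r * u x)) \<le> exp (r * B)"
      using assms by simp
  qed simp
  then have "((\<lambda>R. \<integral>x. indicator {..R} x *\<^sub>R exp (r * u x) \<partial>?Q) \<longlongrightarrow> \<nu>) at_top"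
    unfolding \<nu>_def by (intro tendsto_integral_at_top) auto
  then have "\<forall>\<^sub>F R in at_top. (\<integral>x. indicator {..R} x *\<^sub>R exp (r * u x) \<partial>?Q) > \<nu> - \<eta> / 3"
    using assms by (intro order_tendstoD) auto
  then obtain R where R: "(\<integral>x. indicator {..R} x * exp (r * u x) \<partial>?Q) > \<nu> - \<eta> / 3"
    by (auto simp: eventually_at_top_linorder)
  define K where "K = exp ((r + 1) * B)"
  have K: "exp ((r + 1) * u a) \<le> K" for a
    using abs_le_D1[OF u(2)[of a]] \<open>r > 0\<close> by (simp add: K_def)
  define \<kappa> where "\<kappa> = 1 + \<eta> / (3 * K)"
  have \<kappa>: "\<kappa> > 1" using assms by (simp add: \<kappa>_def K_def)
  have "2 * G / (r + 1) + 2 * G * \<eta> / 3 > Q_const r (exponential_density l)"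
    using Q_const_exponential_le[OF \<open>l > 0\<close> \<open>r > 0\<close>, folded \<mu>_def, folded G_def]
      mult_pos_pos[OF G \<open>\<eta> > 0\<close>] by linarith
  then have "\<forall>\<^sub>F n in sequentially. real n powr r * distortion r (density lborel (exponential_density l)) (\<alpha> n)
      < 2 * G / (r + 1) + 2 * G * \<eta> / 3"
    using opt unfolding asymptotically_optimal_def by (intro order_tendstoD)
  moreover note eventually_distortion_ge[OF \<open>l > 0\<close> \<open>r > 0\<close> \<kappa> u, of R, folded \<mu>_def, folded G_def]
  ultimately show ?thesis
    using eventually_gt_at_top[of 0]
  proof eventually_elim
    case (elim n)
    have A: "finite (\<alpha> n)" "\<alpha> n \<noteq> {}" "card (\<alpha> n) \<le> n"
      using \<alpha> elim by (auto simp: quantizer_seq_def)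
    define E where "E = (\<Sum>a\<in>\<alpha> n. exp ((r + 1) * u a)) / real n"
    define I where "I = (\<integral>x. indicator {..R} x * exp (r * u x) \<partial>?Q)"
    have "2 * G * I - \<kappa> * (2 * r / (r + 1) * G) * E \<le> 2 * G / (r + 1) + 2 * G * \<eta> / 3"
      using elim A unfolding E_def I_def by fastforce
    then have "2 * G * (I - \<kappa> * (r / (r + 1)) * E) \<le> 2 * G * (1 / (r + 1) + \<eta> / 3)"
      by (simp add: algebra_simps)
    then have 1: "I - \<kappa> * (r / (r + 1)) * E \<le> 1 / (r + 1) + \<eta> / 3"
      using G by (subst (asm) mult_le_cancel_left_pos) auto
    have "E \<le> K" unfolding E_def using A elim K by (intro mean_le) (auto simp: K_def)
    moreover have "E \<ge> 0" by (auto simp: E_def intro!: divide_nonneg_nonneg sum_nonneg)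
    ultimately have "r / (r + 1) * E \<le> 1 * K"
      using assms by (intro mult_mono) auto
    then have "\<eta> / (3 * K) * (r / (r + 1) * E) \<le> \<eta> / (3 * K) * K"
      using assms by (intro mult_left_mono) (auto simp: K_def)
    also have "\<dots> = \<eta> / 3" by (simp add: K_def)
    finally have "\<kappa> * (r / (r + 1)) * E \<le> r / (r + 1) * E + \<eta> / 3"
      by (simp add: \<kappa>_def algebra_simps)
    with 1 R show ?case unfolding E_def[symmetric] \<nu>_def[symmetric] I_def[symmetric] by linarith
  qed
qed

lemma exp_le_quadratic:
  fixes x :: real
  assumes "x \<le> 1"
  shows "exp x \<le> 1 + x + x\<^sup>2"
proof (cases "x \<ge> 0")
  case False
  define y where "y = - x"
  have y: "y > 0" using False by (simp add: y_def)
  have 1: "1 + y + y\<^sup>2 / 2 \<le> exp y"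
    using y by (intro exp_lower_Taylor_quadratic) auto
  have 2: "1 - y + y\<^sup>2 > 0" by sos
  have "1 \<le> (1 - y + y\<^sup>2) * (1 + y + y\<^sup>2 / 2)"
  proof -
    have "(1 - y + y\<^sup>2) * (1 + y + y\<^sup>2 / 2) = 1 + y\<^sup>2 / 2 + y ^ 3 / 2 + y ^ 4 / 2"
      by (simp add: field_simps power2_eq_square power3_eq_cube power4_eq_xxxx)
    then show ?thesis using y by simp
  qed
  also have "\<dots> \<le> (1 - y + y\<^sup>2) * exp y"
    using 1 2 by (intro mult_left_mono) auto
  finally have "exp (- y) \<le> 1 - y + y\<^sup>2"
    by (simp add: exp_minus field_simps)
  then show ?thesis by (simp add: y_def)
qed (use assms exp_bound in auto)

text \<open>Linearization of \<open>eventually_exp_mean_ge\<close> at \<open>u = 0\<close>, in the direction \<open>v\<close>. With \<open>q = r / (r + 1)\<close> it says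
  \<open>q * E_n(exp (h * v)) \<ge> \<nu>(exp (q * h * v)) - (1 - q)\<close> up to a small error. The zeroth-order terms
  leave \<open>q\<close> on both sides because \<open>E_n\<close> has mass at most one, and the first-order terms are
  \<open>q * h * E_n(v)\<close> and \<open>q * h * \<nu>(v)\<close>; after division by \<open>q * h\<close> an error of order \<open>h\<close> remains.\<close>

lemma eventually_mean_ge:
  fixes l r :: real
  assumes "l > 0" "r > 0" "\<epsilon> > 0"
    and \<alpha>: "quantizer_seq \<alpha>"
    and opt: "asymptotically_optimal r (density lborel (exponential_density l)) (exponential_density l) \<alpha>"
    and v: "continuous_on UNIV v" "\<And>x. \<bar>v x\<bar> \<le> B"
  defines "\<mu> \<equiv> l / (r + 1)"
  shows "\<forall>\<^sub>F n in sequentially.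
    (\<Sum>a\<in>\<alpha> n. v a) / real n \<ge> (\<integral>x. v x \<partial>density lborel (exponential_density \<mu>)) - \<epsilon>"
proof -
  have \<mu>: "\<mu> > 0" using assms by (auto simp: \<mu>_def)
  have [measurable]: "v \<in> borel_measurable borel"
    using v by (intro borel_measurable_continuous_onI)
  let ?Q = "density lborel (exponential_density \<mu>)"
  interpret prob_space ?Q by (rule prob_space_exponential_density) fact
  have B: "B \<ge> 0" using v(2)[of 0] by linarith
  define q where "q = r / (r + 1)"
  have q: "q > 0" "1 / (r + 1) = 1 - q" using assms by (auto simp: q_def field_simps)
  \<comment> \<open>The first bound gives \<open>h * \<bar>v x\<bar> \<le> 1\<close>, where the quadratic bound for \<open>exp\<close> holds; the final error is \<open>h * (B\<^sup>2 + 1)\<close>.\<close>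
  define h where "h = min (1 / (B + 1)) (\<epsilon> / (B\<^sup>2 + 1))"
  have B1: "B\<^sup>2 + 1 > 0" by (simp add: add_nonneg_pos)
  have h: "h > 0" "h \<le> 1 / (B + 1)" "h \<le> \<epsilon> / (B\<^sup>2 + 1)" using B B1 assms by (auto simp: h_def)
  have "h * B \<le> h * (B + 1)" using h by (intro mult_left_mono) auto
  also have "\<dots> \<le> 1" using h B by (simp add: field_simps)
  finally have hB: "h * B \<le> 1" .
  have h\<epsilon>: "h * (B\<^sup>2 + 1) \<le> \<epsilon>" using h(3) B1 by (simp add: pos_le_divide_eq)
  have hv: "\<bar>h * v x\<bar> \<le> h * B" for x
    using h v(2)[of x] by (simp add: abs_mult)
  \<comment> \<open>The error \<open>q * h\<^sup>2\<close> is of the same order as the quadratic remainder of \<open>exp\<close>.\<close>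
  have "\<forall>\<^sub>F n in sequentially.
    r / (r + 1) * ((\<Sum>a\<in>\<alpha> n. exp ((r + 1) * (h * v a / (r + 1)))) / real n) \<ge>
      (\<integral>x. exp (r * (h * v x / (r + 1))) \<partial>?Q) - 1 / (r + 1) - q * h\<^sup>2"
    unfolding \<mu>_def
  proof (rule eventually_exp_mean_ge[OF \<open>l > 0\<close> \<open>r > 0\<close> _ \<alpha> opt])
    show "\<bar>h * v x / (r + 1)\<bar> \<le> h * B / (r + 1)" for x
      using hv[of x] assms by (simp add: abs_mult divide_right_mono)
  qed (use q h v assms in \<open>auto intro!: continuous_intros\<close>)
  then show ?thesis
    using eventually_gt_at_top[of 0]
  proof eventually_elim
    case (elim n)
    have A: "finite (\<alpha> n)" "\<alpha> n \<noteq> {}" "card (\<alpha> n) \<le> n"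
      using \<alpha> elim by (auto simp: quantizer_seq_def)
    define E where "E = (\<Sum>a\<in>\<alpha> n. v a) / real n"
    define \<nu> where "\<nu> = (\<integral>x. v x \<partial>?Q)"
    have int_v: "integrable ?Q v"
      using v by (intro integrable_const_bound[of _ B]) auto
    have "exp (h * v a) \<le> 1 + h * v a + h\<^sup>2 * B\<^sup>2" for a
    proof -
      have "exp (h * v a) \<le> 1 + h * v a + (h * v a)\<^sup>2"
        using hv[of a] hB by (intro exp_le_quadratic) linarith
      moreover have "(h * v a)\<^sup>2 \<le> (h * B)\<^sup>2"
        using hv[of a] by (simp add: abs_le_square_iff[symmetric])
      ultimately show ?thesis by (simp add: power_mult_distrib)
    qed
    then have "(\<Sum>a\<in>\<alpha> n. exp (h * v a)) / real n \<le> (\<Sum>a\<in>\<alpha> n. (1 + h\<^sup>2 * B\<^sup>2) + h * v a) / real n"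
      by (intro divide_right_mono sum_mono) (auto simp: algebra_simps)
    also have "\<dots> = (\<Sum>a\<in>\<alpha> n. 1 + h\<^sup>2 * B\<^sup>2) / real n + h * E"
      by (simp only: sum.distrib[of "\<lambda>_. 1 + h\<^sup>2 * B\<^sup>2"] E_def sum_distrib_left add_divide_distrib times_divide_eq_right)
    also have "(\<Sum>a\<in>\<alpha> n. 1 + h\<^sup>2 * B\<^sup>2) / real n \<le> 1 + h\<^sup>2 * B\<^sup>2"
      using A elim by (intro mean_le) auto
    finally have "(\<Sum>a\<in>\<alpha> n. exp (h * v a)) / real n \<le> 1 + h\<^sup>2 * B\<^sup>2 + h * E" by simp
    then have up: "q * ((\<Sum>a\<in>\<alpha> n. exp (h * v a)) / real n) \<le> q * (1 + h\<^sup>2 * B\<^sup>2 + h * E)"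
      using q by (intro mult_left_mono) auto
    have "1 + q * h * \<nu> = (\<integral>x. 1 + q * h * v x \<partial>?Q)"
      using int_v prob_space by (simp add: \<nu>_def)
    also have "\<dots> \<le> (\<integral>x. exp (q * h * v x) \<partial>?Q)"
    proof (rule integral_mono)
      show "integrable ?Q (\<lambda>x. 1 + q * h * v x)" using int_v by simp
      have "q * h * v x \<le> q * h * B" for x
        using q h v(2)[of x] by (intro mult_left_mono) auto
      then show "integrable ?Q (\<lambda>x. exp (q * h * v x))"
        by (intro integrable_const_bound[of _ "exp (q * h * B)"]) auto
    qed (rule exp_ge_add_one_self)
    finally have low: "1 + q * h * \<nu> \<le> (\<integral>x. exp (q * h * v x) \<partial>?Q)" .
    have "(\<integral>x. exp (q * h * v x) \<partial>?Q) - (1 - q) - q * h\<^sup>2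
        \<le> q * ((\<Sum>a\<in>\<alpha> n. exp (h * v a)) / real n)"
      using elim(1) assms(2) q(2) by (simp add: q_def mult.assoc)
    with up low have "1 + q * h * \<nu> - (1 - q) - q * h\<^sup>2 \<le> q * (1 + h\<^sup>2 * B\<^sup>2 + h * E)"
      by linarith
    then have "q * h * (\<nu> - h * (B\<^sup>2 + 1)) \<le> q * h * E"
      by (simp add: algebra_simps power2_eq_square)
    then have "\<nu> - h * (B\<^sup>2 + 1) \<le> E"
      using q h by (subst (asm) mult_le_cancel_left_pos) auto
    then show ?case using h\<epsilon> unfolding E_def \<nu>_def by linarith
  qed
qed

text \<open>The empirical measure theorem for the exponent \<open>r\<close> itself, written with means over \<open>\<alpha> n\<close>.\<close>

lemma tendsto_mean:
  fixes l r :: real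
  assumes "l > 0" "r > 0"
    and \<alpha>: "quantizer_seq \<alpha>"
    and opt: "asymptotically_optimal r (density lborel (exponential_density l)) (exponential_density l) \<alpha>"
    and g: "continuous_on UNIV g" "bounded (range g)"
  shows "(\<lambda>n. (\<Sum>a\<in>\<alpha> n. g a) / real n)
    \<longlonglongrightarrow> (\<integral>x. g x \<partial>density lborel (exponential_density (l / (r + 1))))"
proof (rule tendstoI)
  fix e :: real assume "e > 0"
  then have e: "e / 2 > 0" by simp
  obtain B where B: "\<And>x. \<bar>g x\<bar> \<le> B"
    using g(2) by (auto simp: bounded_iff)
  have g': "continuous_on UNIV (\<lambda>x. - g x)" "\<And>x. \<bar>- g x\<bar> \<le> B"
    using g B by (auto intro!: continuous_intros)
  note eventually_mean_ge[OF assms(1,2) e \<alpha> opt g(1) B]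
    eventually_mean_ge[OF assms(1,2) e \<alpha> opt g']
  then show "\<forall>\<^sub>F n in sequentially. dist ((\<Sum>a\<in>\<alpha> n. g a) / real n)
      (\<integral>x. g x \<partial>density lborel (exponential_density (l / (r + 1)))) < e"
    by eventually_elim (use \<open>e > 0\<close> in \<open>auto simp: dist_real_def sum_negf abs_less_iff\<close>)
qed

section \<open>Weak convergence of the dilated empirical measures\<close>

lemma integral_empirical_measure:
  fixes g :: "real \<Rightarrow> real"
  assumes "finite A" "g \<in> borel_measurable borel"
  shows "(\<integral>x. g x \<partial>empirical_measure n A) = (\<Sum>a\<in>A. g a) / real n"
proof -
  have "(\<integral>x. g x \<partial>empirical_measure n A)
      = (\<integral>x. g x \<partial>point_measure A (\<lambda>_. ennreal (1 / real n)))"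
    unfolding empirical_measure_def using assms
    by (subst integral_distr) (auto simp: measurable_def space_point_measure sets_point_measure)
  also have "\<dots> = (\<Sum>a\<in>A. g a) / real n"
    using assms by (subst lebesgue_integral_point_measure_finite) (auto simp: sum_divide_distrib)
  finally show ?thesis .
qed

theorem proposition5p5:
  fixes M :: "'a measure" and X :: "'a \<Rightarrow> real" and r s l :: real
    and \<alpha> :: "nat \<Rightarrow> real set"
  assumes "r > 0" and "s > 0" and "l > 0"
    and "prob_space M"
    and "distributed M lborel X (exponential_density l)"
    and "quantizer_seq \<alpha>"
    and "asymptotically_optimal r (distr M borel X) (exponential_density l) \<alpha>"
  shows "empirical_measure_theorem s (exponential_density l)
           (\<lambda>n. dilate ((s + 1) / (r + 1)) (\<alpha> n))"
  unfolding empirical_measure_theorem_def weakly_converges_def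
proof (intro allI impI, elim conjE)
  fix g :: "real \<Rightarrow> real" assume g: "continuous_on UNIV g" "bounded (range g)"
  have [measurable]: "g \<in> borel_measurable borel"
    using g by (intro borel_measurable_continuous_onI)
  define \<theta> where "\<theta> = (s + 1) / (r + 1)"
  have \<theta>: "\<theta> > 0" "l / (1 + s) * \<theta> = l / (r + 1)"
    using \<open>r > 0\<close> \<open>s > 0\<close> by (auto simp: \<theta>_def add.commute)
  have "distr M borel X = distr M lborel X"
    by (intro distr_cong) auto
  also have "\<dots> = density lborel (exponential_density l)"
    using assms by (simp add: distributed_distr_eq_density)
  finally have opt: "asymptotically_optimal r (density lborel (exponential_density l)) (exponential_density l) \<alpha>"
    using assms by simp
  have "(\<lambda>n. (\<Sum>a\<in>\<alpha> n. g (\<theta> * a)) / real n)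
      \<longlonglongrightarrow> (\<integral>x. g (\<theta> * x) \<partial>density lborel (exponential_density (l / (r + 1))))"
  proof (rule tendsto_mean[OF \<open>l > 0\<close> \<open>r > 0\<close> \<open>quantizer_seq \<alpha>\<close> opt])
    show "continuous_on UNIV (\<lambda>x. g (\<theta> * x))"
      by (rule continuous_on_compose2[OF g(1)]) (auto intro!: continuous_intros)
    show "bounded (range (\<lambda>x. g (\<theta> * x)))"
      using g(2) by (rule bounded_subset) auto
  qed
  also have "(\<integral>x. g (\<theta> * x) \<partial>density lborel (exponential_density (l / (r + 1))))
      = (\<integral>x. g x \<partial>limit_measure (exponential_density l) s)"
    using integral_exponential_scale[of "l / (1 + s)" \<theta> g] assms \<theta>
    by (simp add: limit_measure_exponential)
  finally show "(\<lambda>n. \<integral>x. g x \<partial>empirical_measure n (dilate ((s + 1) / (r + 1)) (\<alpha> n)))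
      \<longlonglongrightarrow> (\<integral>x. g x \<partial>limit_measure (exponential_density l) s)"
  proof (rule Lim_transform_eventually)
    show "\<forall>\<^sub>F n in sequentially. (\<Sum>a\<in>\<alpha> n. g (\<theta> * a)) / real n =
        (\<integral>x. g x \<partial>empirical_measure n (dilate ((s + 1) / (r + 1)) (\<alpha> n)))"
      using eventually_ge_at_top[of 1]
    proof eventually_elim
      case (elim n)
      have "finite (\<alpha> n)" using elim assms by (auto simp: quantizer_seq_def)
      moreover have "inj_on (\<lambda>a. \<theta> * a) (\<alpha> n)" using \<theta> by (auto simp: inj_on_def)
      ultimately show ?case
        unfolding \<theta>_def[symmetric] dilate_def
        by (subst integral_empirical_measure) (auto simp: sum.reindex)
    qed
  qed
qed

end
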